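(* (1) If $\ell$ is a prime with $\ell\equiv 1\pmod{12}$, then the equation $X^2+Y^2+Z^2=3\ell^2$ has no solutions $X,Y,Z\in\mathbb{Z}$ with $X\equiv Y\equiv Z\equiv 5\pmod{12}$. (2) If $\ell$ is a prime with $\ell\equiv 7\pmod{12}$, then the equation $X^2+Y^2+Z^2=3\ell^2$ has no solutions $X,Y,Z\in\mathbb{Z}$ with $X\equiv Y\equiv Z\equiv 1\pmod{12}$. *)

theory Defs
  imports "HOL-Number_Theory.Number_Theory"
begin

end

theory Submission
  imports Defs
begin

text \<open>
  Each congruence condition makes one of
  \<open>(l(1,1,1) \<plusminus> (X,Y,Z)) / 6\<close> a vector \<open>(x,y,z)\<close> of odd integers, and the equation
  turns into \<open>3(x\<^sup>2+y\<^sup>2+z\<^sup>2) = l(x+y+z)\<close>. Hence \<open>x+y+z = 3m\<close> with \<open>m\<close> odd, and writing \<open>x = m+2a\<close>, \<open>y = m+2b\<close>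
  gives \<open>m(l-3m) = 8(a\<^sup>2+ab+b\<^sup>2)\<close> with coprime factors on the left. Primes \<open>p \<equiv> 2 (mod 3)\<close> are
  inert in the Eisenstein integers, so they divide \<open>(l-3m)/8\<close> to an even power and this number is
  not \<open>2\<close> modulo \<open>3\<close>, contradicting \<open>l \<equiv> 1 (mod 3)\<close>.
\<close>

lemma fermat_theorem_int:
  fixes p :: nat and a :: int
  assumes "prime p" "\<not> int p dvd a"
  shows "[a ^ (p - 1) = 1] (mod int p)"
proof -
  have p: "p > 0" using assms(1) prime_gt_0_nat by blast
  define n where "n = nat (a mod int p)"
  have n: "int n = a mod int p" using p by (simp add: n_def)
  have "\<not> p dvd n"
    using assms(2) n by (metis dvd_mod_iff dvd_refl int_dvd_int_iff)
  then have "[int n ^ (p - 1) = 1] (mod int p)"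
    using fermat_theorem[OF assms(1)] by (metis cong_int_iff of_nat_1 of_nat_power)
  moreover have "[a ^ (p - 1) = int n ^ (p - 1)] (mod int p)"
    by (rule cong_pow) (simp add: n cong_def)
  ultimately show ?thesis using cong_trans by blast
qed

text \<open>If \<open>p\<close> divides neither \<open>a\<close> nor \<open>b\<close>, the norm, a
  factor of \<open>a^3 - b^3\<close>, makes the cubes congruent mod \<open>p\<close>. Since
  \<open>p - 1\<close> is one more than a multiple of 3, Fermat then gives a \<equiv> b, so the norm
  is congruent to \<open>3 * (a * b)\<close> and \<open>p\<close> would divide 3.\<close>

lemma prime_dvd_eisenstein_norm:
  fixes p :: nat and a b :: int
  assumes p: "prime p" "p mod 3 = 2" and dvd: "int p dvd a^2 + a*b + b^2"
  shows "int p dvd a \<and> int p dvd b"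
proof -
  have pp: "prime (int p)" using p by simp
  \<comment> \<open>Kept general in \<open>a\<close> and \<open>b\<close>, as it is also applied
    with the two exchanged.\<close>
  have 1: "int p dvd b" if "int p dvd a" "int p dvd a^2 + a*b + b^2" for a b :: int
  proof -
    have "int p dvd a * (a + b)" using that(1) by simp
    then have "int p dvd (a^2 + a*b + b^2) - a * (a + b)" using that(2) dvd_diff by blast
    then have "int p dvd b^2" by (simp add: algebra_simps power2_eq_square)
    then show ?thesis using pp prime_dvd_power by blast
  qed
  have "int p dvd a"
  proof (rule ccontr)
    assume na: "\<not> int p dvd a"
    then have nb: "\<not> int p dvd b"
      using 1[of b a] dvd by (auto simp: algebra_simps)
    define j where "j = p div 3"
    have j: "p - 1 = 3 * j + 1" using p(2) unfolding j_def by presburger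
    have "a^3 - b^3 = (a - b) * (a^2 + a*b + b^2)"
      by (simp add: algebra_simps power2_eq_square power3_eq_cube)
    then have "[a^3 = b^3] (mod int p)"
      using dvd by (simp add: cong_iff_dvd_diff)
    then have c3: "[(a^3)^j = (b^3)^j] (mod int p)" by (rule cong_pow)
    have "[(a^3)^j * a = (b^3)^j * b] (mod int p)"
      using fermat_theorem_int[OF p(1) na] fermat_theorem_int[OF p(1) nb]
      unfolding j by (metis cong_sym cong_trans power_add power_mult power_one_right)
    moreover have "[(b^3)^j * a = (a^3)^j * a] (mod int p)"
      using c3 by (simp add: cong_scalar_right cong_sym)
    ultimately have "[(b^3)^j * a = (b^3)^j * b] (mod int p)"
      using cong_trans by blast
    then have "int p dvd (b^3)^j * (a - b)"
      by (simp add: cong_iff_dvd_diff algebra_simps)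
    then have ab: "int p dvd a - b"
      using nb pp by (metis prime_dvd_multD prime_dvd_power)
    have "(a^2 + a*b + b^2) - (a - b) * (a - b) = 3 * (a * b)"
      by (simp add: algebra_simps power2_eq_square)
    moreover have "int p dvd (a^2 + a*b + b^2) - (a - b) * (a - b)"
      using dvd ab by (intro dvd_diff) auto
    ultimately have "int p dvd 3"
      using na nb pp by (metis prime_dvd_multD)
    then have "p dvd 3" by presburger
    then have "p \<le> 3" by (simp add: dvd_imp_le)
    then have "p = 2" using p(2) by presburger
    then show False using \<open>p dvd 3\<close> by simp
  qed
  then show ?thesis using 1 dvd by blast
qed

text \<open>Strip off any prime factor \<open>q\<close>: it is not 0 mod 3, and if it is 1 mod 3 the
  smaller cofactor is again 2 mod 3.\<close>

lemma obtain_prime_divisor_2_mod_3: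
  fixes k :: nat
  assumes "k mod 3 = 2"
  obtains p where "prime p" "p dvd k" "p mod 3 = 2"
proof -
  have "\<exists>p. prime p \<and> p dvd k \<and> p mod 3 = 2"
    using assms
  proof (induction k rule: less_induct)
    case (less k)
    then have "k \<noteq> 1" "k > 0" by (auto intro!: Nat.gr0I)
    then obtain q where q: "prime q" "q dvd k" using prime_factor_nat by blast
    then obtain r where r: "k = q * r" by blast
    have "q mod 3 = 1 \<Longrightarrow> r mod 3 = 2"
      using less.prems r by (metis mod_mod_trivial mod_mult_left_eq mult_1)
    moreover have "q mod 3 \<noteq> 0"
      using less.prems r by (metis mod_mult_left_eq mult_0 mod_0 zero_neq_numeral)
    moreover have "r < k"
      using r q \<open>k > 0\<close> prime_gt_1_nat by fastforce
    moreover have "q mod 3 = 0 \<or> q mod 3 = 1 \<or> q mod 3 = 2" by linarith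
    ultimately show ?case using less.IH[of r] q r by (metis dvd_mult)
  qed
  then show ?thesis using that by blast
qed

text \<open>Descent: a prime \<open>p\<close> that is 2 mod 3 and divides \<open>k\<close> divides
  both \<open>a\<close> and \<open>b\<close>, so \<open>p^2\<close> divides the norm and, being
  coprime to \<open>m\<close>, divides \<open>k\<close>. Dividing \<open>k\<close> by
  \<open>p^2\<close>, which is 1 mod 3, keeps all hypotheses and the residue of
  \<open>k\<close>.\<close>

lemma coprime_factor_eisenstein_norm:
  fixes a b m :: int and k :: nat
  assumes "coprime m (int k)" "m * int k = a^2 + a*b + b^2"
  shows "k mod 3 \<noteq> 2"
  using assms
proof (induction k arbitrary: a b rule: less_induct)
  case (less k)
  show ?case
  proof
    assume k: "k mod 3 = 2"
    then obtain p where p: "prime p" "p dvd k" "p mod 3 = 2"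
      by (rule obtain_prime_divisor_2_mod_3)
    have "int p dvd a \<and> int p dvd b"
      using p less.prems(2) by (intro prime_dvd_eisenstein_norm) (auto simp flip: less.prems(2))
    then obtain a' b' where ab: "a = int p * a'" "b = int p * b'" by blast
    have eq: "m * int k = int p ^ 2 * (a'^2 + a'*b' + b'^2)"
      using less.prems(2) ab by (simp add: algebra_simps power2_eq_square)
    have "coprime m (int p)"
      using less.prems(1) p(2) by (meson coprime_divisors dvd_refl int_dvd_int_iff)
    then have "coprime (int p ^ 2) m" by (simp add: coprime_commute)
    then have "int p ^ 2 dvd int k"
      using eq by (metis coprime_dvd_mult_right_iff dvd_triv_left)
    then have "p ^ 2 dvd k" by (metis int_dvd_int_iff of_nat_power)
    then obtain r where r: "k = p ^ 2 * r" by blast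
    have "k > 0" using k by (auto intro!: Nat.gr0I)
    have "r < k"
    proof -
      have "1 < p ^ 2" using prime_gt_1_nat[OF p(1)] by (intro one_less_power) auto
      then show ?thesis using r \<open>k > 0\<close> by simp
    qed
    moreover have "coprime m (int r)"
      using less.prems(1) r by simp
    moreover have "m * int r = a'^2 + a'*b' + b'^2"
      using eq r prime_gt_0_nat[OF p(1)] by simp
    ultimately have "r mod 3 \<noteq> 2" using less.IH by blast
    moreover have "p ^ 2 mod 3 = 1"
    proof -
      have "p ^ 2 mod 3 = (p mod 3) ^ 2 mod 3" by (simp add: power_mod)
      then show ?thesis using p(3) by simp
    qed
    ultimately show False
      using k r by (metis mod_mod_trivial mod_mult_left_eq mult_1)
  qed
qed

text \<open>The equation is what remains of the original one after substituting
  \<open>6*x - int l\<close> for X, likewise for Y and Z, and cancelling 12.\<close>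

lemma no_odd_solution:
  fixes x y z :: int and l :: nat
  assumes l: "prime l" "l mod 3 = 1" and odd: "odd x" "odd y" "odd z"
    and eq: "3 * (x^2 + y^2 + z^2) = int l * (x + y + z)"
  shows False
proof -
  have "coprime 3 l"
    using l(2) by (metis coprime_iff_gcd_eq_1 gcd.commute gcd_1_nat gcd_red_nat One_nat_def)
  then have cop3: "coprime 3 (int l)"
    by (metis coprime_int_iff of_nat_numeral)
  then have "3 dvd x + y + z"
    using eq by (metis coprime_dvd_mult_right_iff dvd_triv_left)
  then obtain m where m: "x + y + z = 3 * m" by blast
  have "odd (3 * m)" using odd by (simp flip: m)
  then have oddm: "odd m" by simp
  obtain a b where a: "x = m + 2 * a" and b: "y = m + 2 * b"
  proof -
    have "x = m + 2 * ((x - m) div 2)" "y = m + 2 * ((y - m) div 2)"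
      using odd oddm by presburger+
    then show ?thesis using that by blast
  qed
  define N where "N = a^2 + a*b + b^2"
  have z: "z = m - 2 * a - 2 * b" using m a b by simp
  have "x^2 + y^2 + z^2 = int l * m" using eq m by simp
  \<comment> \<open>The deviations of \<open>x\<close>, \<open>y\<close>, \<open>z\<close> from
    \<open>m\<close> sum to zero, so the cross terms cancel and the sum of squares is
    \<open>3 * m^2 + 8 * N\<close>.\<close>
  then have key: "m * (int l - 3 * m) = 8 * N"
    unfolding a b z N_def by (simp add: algebra_simps power2_eq_square)
  have "4 * N = (2 * a + b)^2 + 3 * b^2"
    by (simp add: N_def algebra_simps power2_eq_square)
  then have N0: "N \<ge> 0"
    by (smt (verit) zero_le_power2)
  have l0: "int l > 0" using prime_gt_0_nat[OF l(1)] by simp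
  have m0: "m > 0"
  proof (rule ccontr)
    assume "\<not> m > 0"
    then have "m < 0" using oddm by (cases "m = 0") auto
    then have "m * (int l - 3 * m) < 0" using l0 by (intro mult_neg_pos) auto
    then show False using key N0 by simp
  qed
  have lm: "int l - 3 * m \<ge> 0"
    using key N0 m0 by (smt (verit) mult_pos_neg)
  \<comment> \<open>The sign bounds give 0 < m and 3m \<le> l, so \<open>m\<close> lies strictly
    between 0 and \<open>l\<close>.\<close>
  have "\<not> int l dvd m" using m0 lm by (auto dest: zdvd_imp_le)
  then have copl: "coprime m (int l)"
    using l(1) by (metis coprime_commute prime_imp_coprime prime_nat_int_transfer)
  have "coprime (2 ^ 3) m" using oddm unfolding coprime_power_left_iff by simp
  then have "coprime 8 m" by simp
  then have "8 dvd int l - 3 * m"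
    using key by (metis coprime_dvd_mult_right_iff dvd_triv_left)
  then obtain k' where k': "int l - 3 * m = 8 * k'" by blast
  define k where "k = nat k'"
  have k: "int l - 3 * m = 8 * int k" using lm k' by (simp add: k_def)
  have "coprime m (int l - 3 * m)"
    using copl gcd_add_mult[of m "- 3" "int l"] by (simp add: coprime_iff_gcd_eq_1)
  then have "coprime m (int k)" unfolding k by simp
  moreover have "m * int k = a^2 + a*b + b^2"
    using key k N_def by simp
  ultimately have "k mod 3 \<noteq> 2" by (rule coprime_factor_eisenstein_norm)
  \<comment> \<open>Modulo 3, \<open>l\<close> is congruent to \<open>8 * k\<close>, hence to
    \<open>2 * k\<close>; as \<open>l\<close> is 1, \<open>k\<close> must be 2.\<close>
  then show False using k l(2) by presburger
qed

theorem theorem5p2: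
  shows "(\<forall>l::nat. prime l \<and> [l = 1] (mod 12) \<longrightarrow>
            \<not> (\<exists>X Y Z :: int. X^2 + Y^2 + Z^2 = 3 * (int l)^2 \<and>
                 [X = 5] (mod 12) \<and> [Y = 5] (mod 12) \<and> [Z = 5] (mod 12)))
       \<and> (\<forall>l::nat. prime l \<and> [l = 7] (mod 12) \<longrightarrow>
            \<not> (\<exists>X Y Z :: int. X^2 + Y^2 + Z^2 = 3 * (int l)^2 \<and>
                 [X = 1] (mod 12) \<and> [Y = 1] (mod 12) \<and> [Z = 1] (mod 12)))"
proof -
  have False
    if l: "prime l" "l mod 3 = 1" and odd: "odd x" "odd y" "odd z"
      and eq: "(6*x - int l)^2 + (6*y - int l)^2 + (6*z - int l)^2 = 3 * (int l)^2"
    for l :: nat and x y z :: int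
  proof (rule no_odd_solution[OF l odd])
    show "3 * (x^2 + y^2 + z^2) = int l * (x + y + z)"
      using eq by (simp add: algebra_simps power2_eq_square)
  qed
  note no_solution = this
  have case1: "\<exists>x. odd x \<and> X = 6 * x - int l" if "[l = 1] (mod 12)" "[X = 5] (mod 12)" for l X
  proof -
    have "int l mod 12 = 1"
      using that(1) zmod_int[of l 12] by (simp add: cong_def)
    moreover have "X mod 12 = 5" using that(2) by (simp add: cong_def)
    ultimately obtain j k where "int l = 12 * j + 1" "X = 12 * k + 5"
      by (metis mult_div_mod_eq)
    \<comment> \<open>Here X + l = 12(j + k) + 6, an odd multiple of 6.\<close>
    then show ?thesis by (intro exI[of _ "2 * (j + k) + 1"]) simp
  qed
  \<comment> \<open>Now l + X is 8 mod 12, but l - X is 6 mod 12; the change of sign is harmless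
    because only squares occur.\<close>
  have case2: "\<exists>x. odd x \<and> - X = 6 * x - int l" if "[l = 7] (mod 12)" "[X = 1] (mod 12)" for l X
  proof -
    have "int l mod 12 = 7"
      using that(1) zmod_int[of l 12] by (simp add: cong_def)
    moreover have "X mod 12 = 1" using that(2) by (simp add: cong_def)
    ultimately obtain j k where "int l = 12 * j + 7" "X = 12 * k + 1"
      by (metis mult_div_mod_eq)
    then show ?thesis by (intro exI[of _ "2 * (j - k) + 1"]) simp
  qed
  show ?thesis
  proof (intro conjI allI impI notI; elim conjE exE)
    fix l :: nat and X Y Z :: int
    assume "prime l" and l: "[l = 1] (mod 12)" and eq: "X^2 + Y^2 + Z^2 = 3 * (int l)^2"
      and c: "[X = 5] (mod 12)" "[Y = 5] (mod 12)" "[Z = 5] (mod 12)"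
    have "l mod 3 = 1"
      using l mod_mod_cancel[of 3 12 l] by (simp add: cong_def)
    then show False
      using no_solution[OF \<open>prime l\<close>] eq case1[OF l c(1)] case1[OF l c(2)] case1[OF l c(3)]
      by blast
  next
    fix l :: nat and X Y Z :: int
    assume "prime l" and l: "[l = 7] (mod 12)" and eq: "X^2 + Y^2 + Z^2 = 3 * (int l)^2"
      and c: "[X = 1] (mod 12)" "[Y = 1] (mod 12)" "[Z = 1] (mod 12)"
    have "l mod 3 = 1"
      using l mod_mod_cancel[of 3 12 l] by (simp add: cong_def)
    moreover have "(- X)^2 + (- Y)^2 + (- Z)^2 = 3 * (int l)^2" using eq by simp
    ultimately show False
      using no_solution[OF \<open>prime l\<close>] case2[OF l c(1)] case2[OF l c(2)] case2[OF l c(3)]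
      by metis
  qed
qed

end
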